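(* For any prime power $q > 2$, there is no linear $(2,q+1,q)$-AONT; that is, there is no invertible $(q+1)\times(q+1)$ matrix over $\mathbb{F}_q$ all of whose $2\times 2$ submatrices are invertible.
   Context: For a prime power $q$ and integers $1 \le t \le s$, a linear $(t,s,q)$-all-or-nothing transform (AONT) is an invertible $s\times s$ matrix $M$ over $\mathbb{F}_q$ defining the bijection $\mathbf{y}\mapsto \mathbf{x}=\mathbf{y}M$ of $\mathbb{F}_q^s$ such that, for every set $I$ of $t$ input coordinates and every set $J$ of $t$ output coordinates, knowing the $s-t$ output values $y_j$, $j\notin J$, gives no information about the values $x_i$, $i \in I$. It is a known fact that an invertible $M$ is a linear $(t,s,q)$-AONT if and only if every $t\times t$ submatrix of $M$ is invertible. *)

theory Defs
  imports
    "HOL-Probability.Probability_Mass_Function"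
    "HOL-Number_Theory.Prime_Powers"
    "Jordan_Normal_Form.DL_Submatrix"
begin

unbundle no vec_syntax

(* JNF vectors are column vectors, so the row-vector product x = y M is M^T y. *)
definition aont_inputs :: "'a::semiring_1 mat \<Rightarrow> 'a vec \<Rightarrow> 'a vec" where
  "aont_inputs M y = M\<^sup>T *\<^sub>v y"

lemma finite_carrier_vec:
  "finite (carrier_vec s :: 'a::finite vec set)"
proof -
  have "carrier_vec s \<subseteq> vec_of_list ` {xs :: 'a list. set xs \<subseteq> UNIV \<and> length xs = s}"
  proof
    fix v :: "'a vec" assume "v \<in> carrier_vec s"
    then have "v = vec_of_list (list_of_vec v)" "length (list_of_vec v) = s"
      by (auto simp: vec_list)
    then show "v \<in> vec_of_list ` {xs. set xs \<subseteq> UNIV \<and> length xs = s}" by blast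
  qed
  then show ?thesis
    by (rule finite_subset) (intro finite_imageI finite_lists_length_eq finite)
qed

(* Uniformly distributed outputs amount to uniformly distributed inputs. *)
lemma map_pmf_aont_inputs:
  fixes M :: "'a::{field,finite} mat"
  assumes M: "M \<in> carrier_mat s s" and "invertible_mat M"
  shows "map_pmf (aont_inputs M) (pmf_of_set (carrier_vec s)) = pmf_of_set (carrier_vec s)"
proof -
  obtain B where B: "M * B = 1\<^sub>m s" "B * M = 1\<^sub>m (dim_row B)"
    using assms by (auto simp: invertible_mat_def inverts_mat_def)
  have "dim_col B = s" using arg_cong[OF B(1), of dim_col] by simp
  moreover have "dim_row B = s" using arg_cong[OF B(2), of dim_col] M by simp
  ultimately have Bc: "B \<in> carrier_mat s s" by auto
  have *: "M\<^sup>T * B\<^sup>T = 1\<^sub>m s" "B\<^sup>T * M\<^sup>T = 1\<^sub>m s"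
    by (simp_all only: transpose_mult[OF Bc M, symmetric] transpose_mult[OF M Bc, symmetric]
        B \<open>dim_row B = s\<close> transpose_one)
  have T: "M\<^sup>T \<in> carrier_mat s s" "B\<^sup>T \<in> carrier_mat s s"
    using M Bc by simp_all
  have "M\<^sup>T *\<^sub>v (B\<^sup>T *\<^sub>v v) = v" "B\<^sup>T *\<^sub>v (M\<^sup>T *\<^sub>v v) = v" if "v \<in> carrier_vec s" for v
    using assoc_mult_mat_vec[OF T that] assoc_mult_mat_vec[OF T(2,1) that] * that by simp_all
  then have "bij_betw (aont_inputs M) (carrier_vec s) (carrier_vec s)"
    using M Bc
    by (intro bij_betw_byWitness[where f' = "\<lambda>v. B\<^sup>T *\<^sub>v v"])
       (auto simp: aont_inputs_def intro!: mult_mat_vec_carrier[OF T(1)] mult_mat_vec_carrier[OF T(2)])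
  then show ?thesis
    by (rule map_pmf_of_set_bij_betw) (use zero_carrier_vec finite_carrier_vec in blast)+
qed

(* Conditioning on y\<^sub>j = z\<^sub>j for all j outside J leaves the law of (x\<^sub>i), i \<in> I, unchanged,
   where z ranges over all possible outputs. *)
definition no_information :: "nat \<Rightarrow> 'a::{field,finite} mat \<Rightarrow> nat set \<Rightarrow> nat set \<Rightarrow> bool" where
  "no_information s M I J \<longleftrightarrow>
    (let P = pmf_of_set (carrier_vec s);
         X = (\<lambda>y. \<lambda>i\<in>I. aont_inputs M y $ i)
     in \<forall>z\<in>carrier_vec s.
          map_pmf X (cond_pmf P {y \<in> carrier_vec s. \<forall>j\<in>{..<s} - J. y $ j = z $ j}) = map_pmf X P)"

definition linear_aont :: "nat \<Rightarrow> nat \<Rightarrow> 'a::{field,finite} mat \<Rightarrow> bool" where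
  "linear_aont t s M \<longleftrightarrow>
    1 \<le> t \<and> t \<le> s \<and> M \<in> carrier_mat s s \<and> invertible_mat M \<and>
    (\<forall>I J. I \<subseteq> {..<s} \<and> card I = t \<and> J \<subseteq> {..<s} \<and> card J = t \<longrightarrow> no_information s M I J)"

definition all_submatrices_invertible :: "nat \<Rightarrow> 'a::field mat \<Rightarrow> bool" where
  "all_submatrices_invertible t M \<longleftrightarrow>
    (\<forall>I J. I \<subseteq> {..<dim_row M} \<and> card I = t \<and> J \<subseteq> {..<dim_col M} \<and> card J = t
       \<longrightarrow> invertible_mat (submatrix M I J))"

end

(* Two rows i, k of a (q+1) x (q+1) matrix M with nonvanishing 2 x 2 minors give q+1 distinct points
   (M_ij : M_kj) of the projective line over F_q, so the quotients M_ij / M_kj at the columns with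
   M_kj \<noteq> 0 run through F_q exactly once. For q > 2 the elements of F_q sum to 0, and for i = k the
   quotients are q ones, which also sum to 0. Hence the vector of the reciprocals of the nonzero
   entries of row k lies in the kernel of M, and M is singular. *)
theory Submission
  imports Defs
begin

section \<open>Kernel vectors and singular 2 x 2 matrices\<close>

lemma invertible_mat_kernel_zero:
  fixes M :: "'a::field mat"
  assumes M: "M \<in> carrier_mat n n" and "invertible_mat M"
    and v: "v \<in> carrier_vec n" and 0: "M *\<^sub>v v = 0\<^sub>v n"
  shows "v = 0\<^sub>v n"
proof -
  obtain B where B: "M * B = 1\<^sub>m n" "B * M = 1\<^sub>m (dim_row B)"
    using assms by (auto simp: invertible_mat_def inverts_mat_def)
  have "dim_col B = n" using arg_cong[OF B(1), of dim_col] by simp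
  moreover have dr: "dim_row B = n" using arg_cong[OF B(2), of dim_col] M by simp
  ultimately have Bc: "B \<in> carrier_mat n n" by auto
  have "v = B *\<^sub>v (M *\<^sub>v v)"
    using assoc_mult_mat_vec[OF Bc M v] v B(2) dr by simp
  then show ?thesis
    unfolding 0 using Bc by (auto simp: mult_mat_vec_def)
qed

lemma mult_mat_vec_index_sum:
  assumes "M \<in> carrier_mat m n" and "v \<in> carrier_vec n" and "i < m"
  shows "(M *\<^sub>v v) $ i = (\<Sum>j<n. M $$ (i, j) * v $ j)"
  using assms by (auto simp: scalar_prod_def lessThan_atLeast0 intro!: sum.cong)

text \<open>A nonzero row \<open>(a, b)\<close> is annihilated by \<open>(b, - a)\<close>, and the
  vanishing determinant says that this vector annihilates the other row too. If the first row is
  zero, the second one plays its role.\<close>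

lemma singular_2x2_kernel:
  fixes a b c d :: "'a::field"
  assumes "a * d = b * c"
  obtains x y where "x \<noteq> 0 \<or> y \<noteq> 0" "a * x + b * y = 0" "c * x + d * y = 0"
proof (cases "a = 0 \<and> b = 0")
  case False
  then show ?thesis
    using assms by (intro that[of b "- a"]) (auto simp: algebra_simps)
next
  case ab: True
  show ?thesis
  proof (cases "c = 0 \<and> d = 0")
    case False
    then show ?thesis
      using ab by (intro that[of d "- c"]) (auto simp: algebra_simps)
  next
    case True
    then show ?thesis
      using ab by (intro that[of 1 0]) auto
  qed
qed

text \<open>A vanishing minor would give the 2 x 2 submatrix a nonzero kernel vector.\<close>

lemma all_submatrices_invertible_2_minor:
  fixes M :: "'a::field mat"
  assumes M: "M \<in> carrier_mat m n" and inv: "all_submatrices_invertible 2 M"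
    and i: "i < i'" "i' < m" and j: "j < j'" "j' < n"
  shows "M $$ (i, j) * M $$ (i', j') \<noteq> M $$ (i, j') * M $$ (i', j)"
proof
  assume "M $$ (i, j) * M $$ (i', j') = M $$ (i, j') * M $$ (i', j)"
  then obtain x y where xy: "x \<noteq> 0 \<or> y \<noteq> 0"
      "M $$ (i, j) * x + M $$ (i, j') * y = 0" "M $$ (i', j) * x + M $$ (i', j') * y = 0"
    by (rule singular_2x2_kernel)
  define A where "A = submatrix M {i, i'} {j, j'}"
  have invA: "invertible_mat A"
    using inv M i j unfolding all_submatrices_invertible_def A_def by auto
  have sets: "{a. a < dim_row M \<and> a \<in> {i, i'}} = {i, i'}" "{a. a < dim_col M \<and> a \<in> {j, j'}} = {j, j'}"
    using M i j by auto
  have A: "A \<in> carrier_mat 2 2"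
    using i j unfolding A_def carrier_mat_def mem_Collect_eq dim_submatrix sets by simp
  have "{a \<in> {i, i'}. a < i} = {}" "{a \<in> {i, i'}. a < i'} = {i}"
      "{a \<in> {j, j'}. a < j} = {}" "{a \<in> {j, j'}. a < j'} = {j}"
    using i j by auto
  then have card: "card {a \<in> {i, i'}. a < i} = 0" "card {a \<in> {i, i'}. a < i'} = 1"
      "card {a \<in> {j, j'}. a < j} = 0" "card {a \<in> {j, j'}. a < j'} = 1"
    by (simp_all only: card.empty card_1_singleton_iff) auto
  \<comment> \<open>\<open>submatrix\<close> renumbers indices by rank: the new index of k counts
    the chosen indices below k. As i < i' and j < j', these ranks are 0 and 1.\<close>
  have "A $$ (card {a \<in> {i, i'}. a < k}, card {a \<in> {j, j'}. a < l}) = M $$ (k, l)"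
    if "k \<in> {i, i'}" "l \<in> {j, j'}" for k l
    unfolding A_def by (rule submatrix_index_card) (use that M i j in auto)
  from this[of i j] this[of i j'] this[of i' j] this[of i' j']
  have ent: "A $$ (0, 0) = M $$ (i, j)" "A $$ (0, 1) = M $$ (i, j')"
      "A $$ (1, 0) = M $$ (i', j)" "A $$ (1, 1) = M $$ (i', j')"
    unfolding card by simp_all
  define v where "v = vec 2 (\<lambda>k. if k = 0 then x else y)"
  have v: "v \<in> carrier_vec 2" by (simp add: v_def)
  have "A *\<^sub>v v = 0\<^sub>v 2"
  proof (rule eq_vecI)
    fix k assume "k < dim_vec (0\<^sub>v 2 :: 'a vec)"
    then have "k < 2" by simp
    then have "(A *\<^sub>v v) $ k = A $$ (k, 0) * x + A $$ (k, 1) * y"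
      unfolding mult_mat_vec_index_sum[OF A v \<open>k < 2\<close>]
      by (simp add: v_def numeral_2_eq_2 lessThan_Suc add.commute)
    then show "(A *\<^sub>v v) $ k = 0\<^sub>v 2 $ k"
      using xy ent \<open>k < 2\<close> by (auto simp: less_2_cases_iff)
  qed (use A in auto)
  from invertible_mat_kernel_zero[OF A invA v this]
  have "v $ 0 = 0" "v $ 1 = 0" by simp_all
  then show False
    using xy(1) by (simp add: v_def)
qed

section \<open>Nonvanishing minors of an all-or-nothing transform\<close>

text \<open>Equal laws have equal supports. Conditioning on zero outputs off J therefore leaves
  every attainable choice of inputs on I attainable.\<close>

lemma no_information_obtain_inputs:
  fixes M :: "'a::{field,finite} mat"
  assumes "no_information s M I J" and y: "y \<in> carrier_vec s"
  obtains y' where "y' \<in> carrier_vec s" "\<And>j. j < s \<Longrightarrow> j \<notin> J \<Longrightarrow> y' $ j = 0"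
    "\<And>i. i \<in> I \<Longrightarrow> aont_inputs M y' $ i = aont_inputs M y $ i"
proof -
  define P :: "'a vec pmf" where "P = pmf_of_set (carrier_vec s)"
  define X where "X = (\<lambda>y. \<lambda>i\<in>I. aont_inputs M y $ i)"
  define A :: "'a vec set" where "A = {y \<in> carrier_vec s. \<forall>j\<in>{..<s} - J. y $ j = 0\<^sub>v s $ j}"
  have P: "set_pmf P = carrier_vec s"
    unfolding P_def using zero_carrier_vec finite_carrier_vec by (subst set_pmf_of_set) blast+
  \<comment> \<open>\<open>cond_pmf\<close> is meaningful only for an event that meets the support;
    the zero vector is a witness.\<close>
  have "0\<^sub>v s \<in> set_pmf P \<inter> A" by (simp add: P A_def)
  then have ne: "set_pmf P \<inter> A \<noteq> {}" by blast
  have "map_pmf X (cond_pmf P A) = map_pmf X P"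
    using assms(1) zero_carrier_vec[of s]
    unfolding no_information_def Let_def P_def X_def A_def by blast
  then have "X ` set_pmf (cond_pmf P A) = X ` set_pmf P"
    by (metis set_map_pmf)
  then have "X y \<in> X ` (set_pmf P \<inter> A)"
    using y by (simp add: set_cond_pmf[OF ne] P)
  then obtain y' where y': "y' \<in> A" "X y = X y'" by auto
  show thesis
  proof (rule that)
    fix i assume "i \<in> I"
    with fun_cong[OF y'(2), of i] show "aont_inputs M y' $ i = aont_inputs M y $ i"
      by (simp add: X_def)
  qed (use y'(1) in \<open>auto simp: A_def\<close>)
qed

lemma aont_inputs_index:
  assumes M: "M \<in> carrier_mat s s" and "y \<in> carrier_vec s" and "i < s"
  shows "aont_inputs M y $ i = (\<Sum>j<s. M $$ (j, i) * y $ j)"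
  using mult_mat_vec_index_sum[of "M\<^sup>T" s s y i] assms by (simp add: aont_inputs_def)

(* A vanishing minor imposes a linear relation on the inputs in I once the outputs off J are fixed
   to 0. As these outputs carry no information, every input satisfies the relation, so two columns
   of M are dependent. *)
lemma linear_aont_2_minor:
  fixes M :: "'a::{field,finite} mat"
  assumes aont: "linear_aont 2 s M"
    and j: "j < j'" "j' < s" and i: "i < i'" "i' < s"
  shows "M $$ (j, i) * M $$ (j', i') \<noteq> M $$ (j, i') * M $$ (j', i)"
proof
  assume "M $$ (j, i) * M $$ (j', i') = M $$ (j, i') * M $$ (j', i)"
  then obtain x y where xy: "x \<noteq> 0 \<or> y \<noteq> 0"
      "M $$ (j, i) * x + M $$ (j, i') * y = 0" "M $$ (j', i) * x + M $$ (j', i') * y = 0"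
    by (rule singular_2x2_kernel)
  have M: "M \<in> carrier_mat s s" and inv: "invertible_mat M"
    using aont by (auto simp: linear_aont_def)
  have lt: "i < s" "j < s" using i j by auto
  have "{i, i'} \<subseteq> {..<s} \<and> card {i, i'} = 2 \<and> {j, j'} \<subseteq> {..<s} \<and> card {j, j'} = 2"
    using i j by auto
  then have ni: "no_information s M {i, i'} {j, j'}"
    using aont unfolding linear_aont_def by blast
  have relation: "M $$ (k, i) * x + M $$ (k, i') * y = 0" if "k < s" for k
  proof -
    \<comment> \<open>The inputs belonging to the unit vector k form row k of M. So, within columns
      i and i', row k becomes a combination of rows j and j', with coefficients from z.\<close>
    obtain z where z: "z \<in> carrier_vec s" "\<And>l. l < s \<Longrightarrow> l \<notin> {j, j'} \<Longrightarrow> z $ l = 0"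
      "\<And>l. l \<in> {i, i'} \<Longrightarrow> aont_inputs M z $ l = aont_inputs M (unit_vec s k) $ l"
      using no_information_obtain_inputs[OF ni unit_vec_carrier[of s k]] by blast
    have entry: "M $$ (k, l) = M $$ (j, l) * z $ j + M $$ (j', l) * z $ j'" if "l \<in> {i, i'}" for l
    proof -
      have "l < s" using that i lt by auto
      have "M $$ (k, l) = (\<Sum>m<s. M $$ (m, l) * unit_vec s k $ m)"
        using \<open>k < s\<close> by (simp add: unit_vec_def if_distrib cong: if_cong)
      also have "\<dots> = (\<Sum>m<s. M $$ (m, l) * z $ m)"
        using z(3)[OF that] aont_inputs_index[OF M z(1) \<open>l < s\<close>]
          aont_inputs_index[OF M unit_vec_carrier \<open>l < s\<close>] by simp
      also have "\<dots> = (\<Sum>m\<in>{j, j'}. M $$ (m, l) * z $ m)"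
        by (rule sum.mono_neutral_right) (use z(2) j lt in auto)
      finally show ?thesis using j by simp
    qed
    have "M $$ (k, i) * x + M $$ (k, i') * y =
        (M $$ (j, i) * x + M $$ (j, i') * y) * z $ j + (M $$ (j', i) * x + M $$ (j', i') * y) * z $ j'"
      unfolding entry[of i, simplified] entry[of i', simplified] by (simp add: algebra_simps)
    then show ?thesis by (simp add: xy)
  qed
  define v where "v = vec s (\<lambda>k. if k = i then x else if k = i' then y else 0)"
  have v: "v \<in> carrier_vec s" by (simp add: v_def)
  have "M *\<^sub>v v = 0\<^sub>v s"
  proof (rule eq_vecI)
    fix k assume "k < dim_vec (0\<^sub>v s :: 'a vec)"
    then have k: "k < s" by simp
    have "(M *\<^sub>v v) $ k = (\<Sum>l\<in>{i, i'}. M $$ (k, l) * v $ l)"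
      unfolding mult_mat_vec_index_sum[OF M v k]
      by (rule sum.mono_neutral_right) (use i lt in \<open>auto simp: v_def\<close>)
    then show "(M *\<^sub>v v) $ k = 0\<^sub>v s $ k"
      using relation[OF k] i lt k by (simp add: v_def)
  qed (use M in auto)
  from invertible_mat_kernel_zero[OF M inv v this]
  have "v $ i = 0" "v $ i' = 0" using i lt by simp_all
  then show False
    using xy(1) i lt by (simp add: v_def)
qed

section \<open>Two sums over a finite field\<close>

text \<open>Multiplication by some c other than 0 and 1 permutes the field, so the sum S satisfies c
  S = S. Such a c exists because q > 2; over the field of two elements the sum is 1.\<close>

lemma sum_UNIV_eq_0:
  assumes "CARD('a::{field,finite}) > 2"
  shows "(\<Sum>x\<in>UNIV. x :: 'a) = 0"
proof -
  have "\<not> UNIV \<subseteq> {0, 1 :: 'a}"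
    using assms card_mono[of "{0, 1 :: 'a}" UNIV] by auto
  then obtain c :: 'a where c: "c \<noteq> 0" "c \<noteq> 1" by auto
  have "bij_betw ((*) c) UNIV UNIV"
    using c by (intro bij_betw_byWitness[where f' = "\<lambda>x. x / c"]) auto
  then have "(\<Sum>x\<in>UNIV. c * x) = (\<Sum>x\<in>UNIV. x)"
    by (rule sum.reindex_bij_betw)
  then have "(c - 1) * (\<Sum>x\<in>UNIV. x) = 0"
    by (simp only: sum_distrib_left[symmetric] left_diff_distrib mult_1_left diff_self)
  then show ?thesis using c by simp
qed

text \<open>Translation by 1 permutes the field and adds q times 1 to the sum of its
  elements.\<close>

lemma of_nat_CARD_eq_0: "of_nat CARD('a::{field,finite}) = (0 :: 'a)"
proof -
  have "bij_betw ((+) 1) UNIV (UNIV :: 'a set)"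
    by (intro bij_betw_byWitness[where f' = "\<lambda>x. x - 1"]) auto
  then have "(\<Sum>x\<in>UNIV. 1 + x) = (\<Sum>x\<in>UNIV. x :: 'a)"
    by (rule sum.reindex_bij_betw)
  then show ?thesis by (simp add: sum.distrib)
qed

section \<open>Row quotients and the kernel vector\<close>

text \<open>Equal quotients, or two zeros in row k, would make a minor vanish. Hence at least q of
  the q + 1 columns yield pairwise distinct quotients, and these exhaust the q field
  elements.\<close>

lemma row_quotients_bij_betw:
  fixes M :: "'a::{field,finite} mat"
  assumes minor: "\<And>j j'. j < j' \<Longrightarrow> j' < CARD('a) + 1 \<Longrightarrow>
      M $$ (i, j) * M $$ (k, j') \<noteq> M $$ (i, j') * M $$ (k, j)"
  shows "bij_betw (\<lambda>j. M $$ (i, j) / M $$ (k, j))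
    {j. j < CARD('a) + 1 \<and> M $$ (k, j) \<noteq> 0} UNIV"
proof -
  let ?n = "CARD('a) + 1"
  let ?S = "{j. j < ?n \<and> M $$ (k, j) \<noteq> 0}" and ?Z = "{j. j < ?n \<and> M $$ (k, j) = 0}"
  let ?f = "\<lambda>j. M $$ (i, j) / M $$ (k, j)"
  have minor': "M $$ (i, j) * M $$ (k, j') \<noteq> M $$ (i, j') * M $$ (k, j)"
    if "j < ?n" "j' < ?n" "j \<noteq> j'" for j j'
    using minor[of j j'] minor[of j' j] that by (metis nat_neq_iff)
  have inj: "inj_on ?f ?S"
    by (rule inj_onI) (use minor' in \<open>auto simp: frac_eq_eq\<close>)
  have "card ?Z \<le> 1"
  proof -
    have "j = j'" if "j \<in> ?Z" "j' \<in> ?Z" for j j'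
      using minor'[of j j'] that by fastforce
    then show ?thesis
      by (simp add: card_le_Suc0_iff_eq)
  qed
  moreover have "card ?S + card ?Z = ?n"
  proof -
    have "card ?S + card ?Z = card (?S \<union> ?Z)" by (subst card_Un_disjoint) auto
    also have "?S \<union> ?Z = {..<?n}" by auto
    finally show ?thesis by simp
  qed
  ultimately have "CARD('a) \<le> card ?S" by linarith
  then have "CARD('a) \<le> card (?f ` ?S)"
    by (simp only: card_image[OF inj])
  then have "?f ` ?S = UNIV"
    by (intro card_seteq) auto
  then show ?thesis using inj by (simp add: bij_betw_def)
qed

text \<open>The common core of both claims: each notion yields exactly such minors. Row 0 supplies
  the denominators.\<close>

lemma nonvanishing_minors_not_invertible:
  fixes M :: "'a::{field,finite} mat"
  assumes q: "CARD('a) > 2" and M: "M \<in> carrier_mat (CARD('a) + 1) (CARD('a) + 1)"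
    and minor: "\<And>i i' j j'. i < i' \<Longrightarrow> i' < CARD('a) + 1 \<Longrightarrow> j < j' \<Longrightarrow> j' < CARD('a) + 1 \<Longrightarrow>
      M $$ (i, j) * M $$ (i', j') \<noteq> M $$ (i, j') * M $$ (i', j)"
  shows "\<not> invertible_mat M"
proof
  assume inv: "invertible_mat M"
  let ?n = "CARD('a) + 1"
  let ?S = "{j. j < ?n \<and> M $$ (0, j) \<noteq> 0}"
  have bij: "bij_betw (\<lambda>j. M $$ (i, j) / M $$ (0, j)) ?S UNIV" if "0 < i" "i < ?n" for i
    by (rule row_quotients_bij_betw) (use minor[of 0 i] that in \<open>metis mult.commute\<close>)
  \<comment> \<open>Comparison with row 1 shows that row 0 has exactly one zero entry.\<close>
  have cardS: "card ?S = CARD('a)"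
    using bij_betw_same_card[OF bij[of 1]] q by simp
  \<comment> \<open>Since \<open>inverse 0 = 0\<close>, v vanishes at the zero entry of row 0, and
    that column drops out of the sums below.\<close>
  define v where "v = vec ?n (\<lambda>j. inverse (M $$ (0, j)))"
  have v: "v \<in> carrier_vec ?n" by (simp add: v_def)
  have "M *\<^sub>v v = 0\<^sub>v ?n"
  proof (rule eq_vecI)
    fix i assume "i < dim_vec (0\<^sub>v ?n :: 'a vec)"
    then have i: "i < ?n" by simp
    have "(M *\<^sub>v v) $ i = (\<Sum>j<?n. M $$ (i, j) / M $$ (0, j))"
      unfolding mult_mat_vec_index_sum[OF M v i] by (simp add: v_def divide_inverse)
    also have "\<dots> = (\<Sum>j\<in>?S. M $$ (i, j) / M $$ (0, j))"
      by (rule sum.mono_neutral_right) auto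
    also have "\<dots> = 0"
    proof (cases "i = 0")
      case True
      then have "(\<Sum>j\<in>?S. M $$ (i, j) / M $$ (0, j)) = (\<Sum>j\<in>?S. 1)"
        by (intro sum.cong) auto
      then show ?thesis using cardS of_nat_CARD_eq_0[where 'a = 'a] by simp
    next
      case False
      then show ?thesis
        using sum.reindex_bij_betw[OF bij[of i], of "\<lambda>x. x"] i sum_UNIV_eq_0[OF q] by simp
    qed
    finally show "(M *\<^sub>v v) $ i = 0\<^sub>v ?n $ i" using i by simp
  qed (use M in auto)
  from invertible_mat_kernel_zero[OF M inv v this]
  have "v $ j = 0" if "j < ?n" for j using that by simp
  \<comment> \<open>An inverse is 0 only for the element 0, so v = 0 forces row 0 to vanish and with
    it the minor of rows 0, 1 and columns 0, 1.\<close>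
  then have "M $$ (0, j) = 0" if "j < ?n" for j using that by (simp add: v_def)
  then show False using minor[of 0 1 0 1] q by simp
qed

theorem theorem10:
  fixes q :: nat
  assumes "primepow q" and "q > 2" and "CARD('a::{field,finite}) = q"
  shows "\<not> (\<exists>M :: 'a mat. linear_aont 2 (q + 1) M) \<and>
         \<not> (\<exists>M :: 'a mat. M \<in> carrier_mat (q + 1) (q + 1) \<and> invertible_mat M \<and>
               all_submatrices_invertible 2 M)"
proof (intro conjI notI; elim exE conjE)
  fix M :: "'a mat"
  assume M: "linear_aont 2 (q + 1) M"
  then have "M \<in> carrier_mat (q + 1) (q + 1)" "invertible_mat M"
    by (auto simp: linear_aont_def)
  then show False
    using nonvanishing_minors_not_invertible[of M] linear_aont_2_minor[OF M] assms(2,3) by simp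
next
  fix M :: "'a mat"
  assume "M \<in> carrier_mat (q + 1) (q + 1)" "invertible_mat M" "all_submatrices_invertible 2 M"
  then show False
    using nonvanishing_minors_not_invertible[of M]
      all_submatrices_invertible_2_minor[of M "q + 1" "q + 1"] assms(2,3) by simp
qed

end
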